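(* Fix $a\in\mathbb{Z}$, let $\delta=a^2-4$, and define $(u_n)_{n\geq 0}$ and $(v_n)_{n\geq 0}$ by $u_0=0$, $u_1=1$, $u_{n+2}=au_{n+1}-u_n$ and $v_0=2$, $v_1=a$, $v_{n+2}=av_{n+1}-v_n$. Let $n,k\in\mathbb{Z}_{>0}$ with $u_n\neq 0$ and $k$ odd, and let $\ell\geq 3$ be a prime. Suppose that $\ell\nmid\delta$ and $\ell\mid u_n$. Set $r=v_\ell(u_n)\geq 1$. Define $h_\ell=1$ if $\ell=3$, and $h_\ell=0$ otherwise. (1) Set $\tau=v_\ell(k(k^2-1))$. If $\tau<2r+h_\ell$, then $$v_\ell\left(\frac{u_{nk}}{u_n}-k\right)=2r+\tau-h_\ell\quad\text{and}\quad v_\ell(u_{nk}-ku_n)=3r+\tau-h_\ell.$$ (2) Set $\tau'=v_\ell(k^2-1)$. If $\tau'<2r$, then $v_\ell(v_{nk}-v_n)=2r+\tau'$.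
   Context: For a prime $\ell$, $v_\ell(\cdot)$ denotes the usual $\ell$-adic valuation on $\mathbb{Q}$, with $v_\ell(0)=\infty$ (not to be confused with the terms $v_n$ of the companion sequence). *)

theory Defs
  imports "HOL-Library.Extended_Real" "HOL-Computational_Algebra.Primes"
begin

fun lucas_u :: "int \<Rightarrow> nat \<Rightarrow> int" where
  "lucas_u a 0 = 0"
| "lucas_u a (Suc 0) = 1"
| "lucas_u a (Suc (Suc n)) = a * lucas_u a (Suc n) - lucas_u a n"

fun lucas_v :: "int \<Rightarrow> nat \<Rightarrow> int" where
  "lucas_v a 0 = 2"
| "lucas_v a (Suc 0) = a"
| "lucas_v a (Suc (Suc n)) = a * lucas_v a (Suc n) - lucas_v a n"

text \<open>The valuation takes values in the integers together with \<open>\<infinity>\<close>, embedded in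
  \<^typ>\<open>ereal\<close>. The case \<open>x = 0\<close> has to be separate because the library sets
  \<^term>\<open>multiplicity p 0 = 0\<close>.\<close>

definition padic_val :: "nat \<Rightarrow> rat \<Rightarrow> ereal" where
  "padic_val p x =
    (if x = 0 then \<infinity>
     else ereal (real (multiplicity (int p) (fst (quotient_of x)))
               - real (multiplicity (int p) (snd (quotient_of x)))))"

end

theory Submission imports Defs begin

text \<open>Put \<open>U\<^sub>j = u\<^sub>j(v\<^sub>n)\<close> and \<open>V\<^sub>j = v\<^sub>j(v\<^sub>n)\<close>, the Lucas sequences with parameter \<open>v\<^sub>n\<close>, so that
  \<open>u\<^sub>n\<^sub>k = u\<^sub>n U\<^sub>k\<close> and \<open>v\<^sub>n\<^sub>k = V\<^sub>k\<close>. For odd \<open>k\<close> both \<open>U\<^sub>k\<close> and \<open>V\<^sub>k / v\<^sub>n\<close> are integer polynomials in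
  \<open>D = v\<^sub>n\<^sup>2 - 4 = \<delta> u\<^sub>n\<^sup>2\<close>, with
  \<open>U\<^sub>k \<equiv> k + k(k\<^sup>2 - 1)/24 D\<close> and \<open>V\<^sub>k \<equiv> v\<^sub>n (1 + (k\<^sup>2 - 1)/8 D)\<close> modulo \<open>D\<^sup>2\<close>. As \<open>l\<close> does not
  divide \<open>\<delta>\<close>, the valuation of \<open>D\<close> is \<open>2r\<close>, and the bounds on \<open>\<tau>\<close> and \<open>\<tau>'\<close> say precisely
  that the linear term has smaller valuation than \<open>D\<^sup>2\<close>.\<close>

section \<open>Index multiplication in Lucas sequences\<close>

text \<open>Terms of \<open>s\<close> taken at stride \<open>n\<close> obey the same kind of
  recurrence with \<open>a\<close> replaced by \<open>lucas_v a n\<close>; this is what makes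
  \<open>u\<close> and \<open>v\<close> composable. For roots x, 1/x it is (x^n + x^-n) x^(m+n) =
  x^(m+2n) + x^m.\<close>

lemma lucas_recurrence_stride:
  fixes s :: "nat \<Rightarrow> int"
  assumes rec: "\<And>i. s (Suc (Suc i)) = a * s (Suc i) - s i"
  shows "s (m + 2 * n) = lucas_v a n * s (m + n) - s m"
proof (induction n arbitrary: m rule: less_induct)
  case (less n)
  consider "n = 0" | "n = 1" | j where "n = Suc (Suc j)"
    by (metis One_nat_def not0_implies_Suc)
  then show ?case
  proof cases
    case 3
    \<comment> \<open>Stride j + 1 from m + 1 and stride j from m + 2 share the midpoint m + j + 2,
      so their coefficients combine by the recurrence for \<open>lucas_v\<close>.\<close>
    have "s (m + 2 * j + 3) = lucas_v a (Suc j) * s (m + j + 2) - s (m + 1)"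
      using less[of "Suc j" "m + 1"] 3 by (simp add: eval_nat_numeral algebra_simps)
    moreover have "s (m + 2 * j + 2) = lucas_v a j * s (m + j + 2) - s (m + 2)"
      using less[of j "m + 2"] 3 by (simp add: eval_nat_numeral algebra_simps)
    moreover have "s (m + 2 * j + 4) = a * s (m + 2 * j + 3) - s (m + 2 * j + 2)"
      using rec[of "m + 2 * j + 2"] by (simp add: eval_nat_numeral)
    moreover have "s (m + 2) = a * s (m + 1) - s m"
      using rec[of m] by (simp add: eval_nat_numeral)
    ultimately have "s (m + 2 * j + 4) = (a * lucas_v a (Suc j) - lucas_v a j) * s (m + j + 2) - s m"
      by algebra
    then show ?thesis
      using 3 by (simp add: eval_nat_numeral)
  qed (use rec in auto)
qed

lemma lucas_u_mult: "lucas_u a (n * k) = lucas_u a n * lucas_u (lucas_v a n) k"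
proof (induction "lucas_v a n" k rule: lucas_u.induct)
  case (3 k)
  then show ?case
    using lucas_recurrence_stride[of "lucas_u a" a "n * k" n]
    by (simp add: algebra_simps mult_2_right)
qed auto

lemma lucas_v_mult: "lucas_v a (n * k) = lucas_v (lucas_v a n) k"
proof (induction "lucas_v a n" k rule: lucas_v.induct)
  case (3 k)
  then show ?case
    using lucas_recurrence_stride[of "lucas_v a" a "n * k" n]
    by (simp add: algebra_simps mult_2_right)
qed auto

lemma lucas_v_square: "(lucas_v a n)\<^sup>2 = (a\<^sup>2 - 4) * (lucas_u a n)\<^sup>2 + 4"
proof -
  \<comment> \<open>Squaring \<open>a * ?q - ?p\<close> produces a mixed product, so the induction
    must also carry the next square and that product.\<close>
  have "(lucas_v a n)\<^sup>2 = (a\<^sup>2 - 4) * (lucas_u a n)\<^sup>2 + 4 \<and>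
        (lucas_v a (Suc n))\<^sup>2 = (a\<^sup>2 - 4) * (lucas_u a (Suc n))\<^sup>2 + 4 \<and>
        lucas_v a n * lucas_v a (Suc n) = (a\<^sup>2 - 4) * lucas_u a n * lucas_u a (Suc n) + 2 * a"
  proof (induction n)
    case (Suc n)
    let ?x = "lucas_u a n" and ?y = "lucas_u a (Suc n)"
      and ?p = "lucas_v a n" and ?q = "lucas_v a (Suc n)"
    have "(a * ?q - ?p)\<^sup>2 = (a\<^sup>2 - 4) * (a * ?y - ?x)\<^sup>2 + 4"
      using Suc by algebra
    moreover have "?q * (a * ?q - ?p) = (a\<^sup>2 - 4) * ?y * (a * ?y - ?x) + 2 * a"
      using Suc by algebra
    ultimately show ?case
      using Suc by simp
  qed (simp add: power2_eq_square)
  then show ?thesis ..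
qed

section \<open>Odd-index terms modulo the square of D = c^2 - 4\<close>

text \<open>For k = 2m + 1 the right side is k(k^2 - 1). Keeping the factor 24 on the left avoids
  division in the coefficient of D.\<close>

lemma sum_squares_odd: "24 * (\<Sum>i\<le>m. (int i)\<^sup>2) = (2 * int m + 1) * ((2 * int m + 1)\<^sup>2 - 1)"
  by (induction m) (simp_all add: power2_eq_square algebra_simps)

lemma sum_naturals_odd: "8 * (\<Sum>i\<le>m. int i) = (2 * int m + 1)\<^sup>2 - 1"
  by (induction m) (simp_all add: power2_eq_square algebra_simps)

text \<open>Odd-index terms satisfy x'' = (D + 2) x' - x. Hence the constant terms form an
  arithmetic progression, and the coefficient of D has second difference 2j + 3 = (j + 2)^2 - (j +
  1)^2, which gives the sum of squares.\<close>

lemma lucas_u_odd_expansion: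
  "\<exists>t. lucas_u c (2 * m + 1) =
        (2 * int m + 1) + (\<Sum>i\<le>m. (int i)\<^sup>2) * (c\<^sup>2 - 4) + (c\<^sup>2 - 4)\<^sup>2 * t"
proof (induction m rule: less_induct)
  case (less m)
  consider "m = 0" | "m = 1" | j where "m = Suc (Suc j)"
    by (metis One_nat_def not0_implies_Suc)
  then show ?case
  proof cases
    case 2
    then show ?thesis
      by (intro exI[of _ 0]) (simp add: eval_nat_numeral)
  next
    case 3
    define D and S where "D = c\<^sup>2 - 4" and "S = (\<Sum>i\<le>j. (int i)\<^sup>2)"
    from less[of j] less[of "Suc j"] 3 obtain s t where
      s: "lucas_u c (2 * j + 1) = (2 * int j + 1) + S * D + D\<^sup>2 * s" and
      t: "lucas_u c (2 * j + 3) = (2 * int j + 3) + (S + (int j + 1)\<^sup>2) * D + D\<^sup>2 * t"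
      by (auto simp: D_def S_def eval_nat_numeral algebra_simps)
    have "lucas_u c (2 * j + 5) = (c\<^sup>2 - 2) * lucas_u c (2 * j + 3) - lucas_u c (2 * j + 1)"
      by (simp add: eval_nat_numeral algebra_simps)
    also have "c\<^sup>2 - 2 = D + 2"
      by (simp add: D_def)
    \<comment> \<open>The summand \<open>S + (int j + 1)\<^sup>2\<close> in the new remainder is the
      old coefficient of D, multiplied by D once more.\<close>
    finally have "lucas_u c (2 * j + 5) =
        (2 * int j + 5) + (S + (int j + 1)\<^sup>2 + (int j + 2)\<^sup>2) * D +
        D\<^sup>2 * (S + (int j + 1)\<^sup>2 + (D + 2) * t - s)"
      unfolding s t by algebra
    moreover have "2 * m + 1 = 2 * j + 5" "2 * int m + 1 = 2 * int j + 5"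
      using 3 by simp_all
    moreover have "(\<Sum>i\<le>m. (int i)\<^sup>2) = S + (int j + 1)\<^sup>2 + (int j + 2)\<^sup>2"
      using 3 by (simp add: S_def algebra_simps)
    ultimately show ?thesis
      unfolding D_def by metis
  qed auto
qed

text \<open>Same recurrence after factoring out c: the constant term stays 1, so the coefficient of
  D has second difference 1.\<close>

lemma lucas_v_odd_expansion:
  "\<exists>t. lucas_v c (2 * m + 1) = c * (1 + (\<Sum>i\<le>m. int i) * (c\<^sup>2 - 4) + (c\<^sup>2 - 4)\<^sup>2 * t)"
proof (induction m rule: less_induct)
  case (less m)
  consider "m = 0" | "m = 1" | j where "m = Suc (Suc j)"
    by (metis One_nat_def not0_implies_Suc)
  then show ?case
  proof cases
    case 2
    then show ?thesis
      by (intro exI[of _ 0]) (simp add: eval_nat_numeral algebra_simps)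
  next
    case 3
    define D and S where "D = c\<^sup>2 - 4" and "S = (\<Sum>i\<le>j. int i)"
    from less[of j] less[of "Suc j"] 3 obtain s t where
      s: "lucas_v c (2 * j + 1) = c * (1 + S * D + D\<^sup>2 * s)" and
      t: "lucas_v c (2 * j + 3) = c * (1 + (S + (int j + 1)) * D + D\<^sup>2 * t)"
      by (auto simp: D_def S_def eval_nat_numeral algebra_simps)
    have "lucas_v c (2 * j + 5) = (c\<^sup>2 - 2) * lucas_v c (2 * j + 3) - lucas_v c (2 * j + 1)"
      by (simp add: eval_nat_numeral algebra_simps)
    also have "c\<^sup>2 - 2 = D + 2"
      by (simp add: D_def)
    finally have "lucas_v c (2 * j + 5) =
        c * (1 + (S + (int j + 1) + (int j + 2)) * D +
        D\<^sup>2 * (S + (int j + 1) + (D + 2) * t - s))"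
      unfolding s t by algebra
    moreover have "2 * m + 1 = 2 * j + 5"
      using 3 by simp
    moreover have "(\<Sum>i\<le>m. int i) = S + (int j + 1) + (int j + 2)"
      using 3 by (simp add: S_def algebra_simps)
    ultimately show ?thesis
      unfolding D_def by metis
  qed auto
qed

section \<open>Valuations\<close>

lemma padic_val_of_int:
  "x \<noteq> 0 \<Longrightarrow> padic_val p (of_int x) = ereal (real (multiplicity (int p) x))"
  by (simp add: padic_val_def)

lemma multiplicity_add_higher:
  fixes p x y :: int
  assumes "prime p" "x \<noteq> 0" "p ^ Suc (multiplicity p x) dvd y"
  shows "x + y \<noteq> 0" and "multiplicity p (x + y) = multiplicity p x"
proof -
  have nd: "\<not> p ^ Suc (multiplicity p x) dvd x"
    using assms(1,2) power_dvd_iff_le_multiplicity[of x p "Suc (multiplicity p x)"]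
    by (metis Suc_n_not_le_n not_prime_unit)
  then have nd': "\<not> p ^ Suc (multiplicity p x) dvd x + y"
    using assms(3) by (simp add: dvd_add_left_iff)
  then show "x + y \<noteq> 0" by force
  have "p ^ multiplicity p x dvd x + y"
    using assms(3) by (meson dvd_add multiplicity_dvd power_le_dvd lessI less_imp_le)
  then show "multiplicity p (x + y) = multiplicity p x"
    using nd' by (intro multiplicity_eqI)
qed

text \<open>The sum is D(S + D t), and S has strictly smaller valuation than D t, so S decides the
  second factor.\<close>

lemma multiplicity_linear_term:
  fixes p D S t :: int
  assumes "prime p" "D \<noteq> 0" "S \<noteq> 0" "multiplicity p S < multiplicity p D"
  shows "S * D + D\<^sup>2 * t \<noteq> 0"
    and "multiplicity p (S * D + D\<^sup>2 * t) = multiplicity p D + multiplicity p S"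
proof -
  have "p ^ Suc (multiplicity p S) dvd D * t"
    using assms(4) by (intro dvd_mult2 multiplicity_dvd') simp
  note * = multiplicity_add_higher[OF assms(1,3) this]
  have eq: "S * D + D\<^sup>2 * t = D * (S + D * t)"
    by (simp add: power2_eq_square algebra_simps)
  show "S * D + D\<^sup>2 * t \<noteq> 0"
    using * assms(2) by (simp add: eq)
  show "multiplicity p (S * D + D\<^sup>2 * t) = multiplicity p D + multiplicity p S"
    using * assms(2)
    by (simp add: eq prime_elem_multiplicity_mult_distrib[OF prime_imp_prime_elem[OF assms(1)]])
qed

lemma odd_prime_not_dvd_8:
  assumes "prime l" "l \<ge> 3"
  shows "\<not> int l dvd 8"
proof
  assume "int l dvd 8"
  then have "int l dvd 2 ^ 3" by simp
  then have "int l dvd 2"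
    using assms(1) by (meson prime_dvd_power prime_nat_int_transfer)
  then show False using assms(2) zdvd_imp_le by force
qed

text \<open>This is the origin of the correction \<open>h\<close> in the theorem.\<close>

lemma multiplicity_24:
  assumes "prime l" "l \<ge> 3"
  shows "multiplicity (int l) 24 = (if l = 3 then 1 else 0)"
proof -
  have p: "prime (int l)" using assms by simp
  have "multiplicity (int l) 3 = (if l = 3 then 1 else 0)"
  proof (cases "l = 3")
    case False
    then have "\<not> l dvd 3"
      using assms(2) dvd_imp_le[of l 3] by auto
    then show ?thesis
      using False by (metis int_dvd_int_iff not_dvd_imp_multiplicity_0 of_nat_numeral)
  qed simp
  moreover have "multiplicity (int l) (8 * 3) = multiplicity (int l) 8 + multiplicity (int l) 3"
    using p by (intro prime_elem_multiplicity_mult_distrib) auto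
  ultimately show ?thesis
    using odd_prime_not_dvd_8[OF assms] by (simp add: not_dvd_imp_multiplicity_0)
qed

theorem corollary5p3:
  fixes a \<delta> :: int and n k l :: nat and r h \<tau> \<tau>' :: ereal
  assumes "\<delta> = a\<^sup>2 - 4"
    and "n > 0" and "k > 0" and "lucas_u a n \<noteq> 0" and "odd k"
    and "prime l" and "l \<ge> 3"
    and "\<not> int l dvd \<delta>" and "int l dvd lucas_u a n"
    and "r = padic_val l (of_int (lucas_u a n))"
    and "h = (if l = 3 then 1 else 0)"
    and "\<tau> = padic_val l (of_nat k * ((of_nat k)\<^sup>2 - 1))"
    and "\<tau>' = padic_val l ((of_nat k)\<^sup>2 - 1)"
  shows "(\<tau> < 2 * r + h \<longrightarrow>
            padic_val l (of_int (lucas_u a (n * k)) / of_int (lucas_u a n) - of_nat k)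
              = 2 * r + \<tau> - h
          \<and> padic_val l (of_int (lucas_u a (n * k)) - of_nat k * of_int (lucas_u a n))
              = 3 * r + \<tau> - h)
       \<and> (\<tau>' < 2 * r \<longrightarrow>
            padic_val l (of_int (lucas_v a (n * k)) - of_int (lucas_v a n)) = 2 * r + \<tau>')"
proof -
  define p where "p = int l"
  have p: "prime p" using assms(6) by (simp add: p_def)
  note mult_distrib = prime_elem_multiplicity_mult_distrib[OF prime_imp_prime_elem[OF p]]
  define u and v where "u = lucas_u a n" and "v = lucas_v a n"
  define D where "D = v\<^sup>2 - 4"
  have D: "D = \<delta> * u\<^sup>2"
    using lucas_v_square[of a n] by (simp add: D_def u_def v_def assms(1))
  have u0: "u \<noteq> 0" and D0: "D \<noteq> 0"
    using assms(4,8) by (auto simp: D u_def)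
  define R where "R = multiplicity p u"
  have r: "r = ereal (real R)"
    using assms(4,10) by (simp add: padic_val_of_int R_def u_def p_def)
  have "\<delta> \<noteq> 0" "multiplicity p \<delta> = 0"
    using assms(8) by (auto simp: p_def not_dvd_imp_multiplicity_0)
  then have mD: "multiplicity p D = 2 * R"
    using u0 prime_imp_prime_elem[OF p]
    by (metis D R_def add_0 power_eq_0_iff prime_elem_multiplicity_mult_distrib
        prime_elem_multiplicity_power_distrib)
  obtain m where m: "k = 2 * m + 1"
    using assms(5) by (elim oddE)
  have k: "int k = 2 * int m + 1" by (simp add: m)
  define H :: nat where "H = (if l = 3 then 1 else 0)"
  have h: "h = ereal (real H)" by (simp add: H_def assms(11))
  show ?thesis
  proof (intro conjI impI)
    assume less: "\<tau> < 2 * r + h"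
    define K where "K = int k * ((int k)\<^sup>2 - 1)"
    define S where "S = (\<Sum>i\<le>m. (int i)\<^sup>2)"
    have K: "24 * S = K"
      unfolding K_def S_def k by (rule sum_squares_odd)
    have \<tau>: "\<tau> = padic_val l (of_int K)"
      by (simp add: assms(12) K_def)
    \<comment> \<open>If K were 0, \<tau> would be infinite, against the strict finite
      bound.\<close>
    have "K \<noteq> 0"
      using less by (auto simp: \<tau> padic_val_def r h)
    then have S0: "S \<noteq> 0" using K by auto
    define T where "T = multiplicity p S"
    have "multiplicity p K = H + T"
      using S0 multiplicity_24[OF assms(6,7), folded p_def]
      by (simp add: mult_distrib T_def H_def flip: K)
    then have \<tau>': "\<tau> = ereal (real (H + T))"
      using \<tau> \<open>K \<noteq> 0\<close> by (simp add: padic_val_of_int p_def)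
    \<comment> \<open>Since \<tau> = H + T, the correction \<open>h\<close> cancels from both sides
      of the bound.\<close>
    have "T < 2 * R"
      using less by (simp add: \<tau>' r h)
    obtain t where t: "lucas_u v k = int k + S * D + D\<^sup>2 * t"
      using lucas_u_odd_expansion[of v m] unfolding k D_def S_def unfolding m by blast
    \<comment> \<open>X is the quotient minus k, of valuation 2R + T with T = \<tau> - h;
      multiplying by u adds another R.\<close>
    define X where "X = S * D + D\<^sup>2 * t"
    have X: "X \<noteq> 0" "multiplicity p X = 2 * R + T"
      using multiplicity_linear_term[OF p D0 S0, of t] \<open>T < 2 * R\<close> by (auto simp: mD X_def T_def)
    have U: "lucas_u a (n * k) = u * (int k + X)"
      unfolding lucas_u_mult X_def using t by (simp add: add.assoc flip: u_def v_def)
    have "rat_of_int (lucas_u a (n * k)) / of_int (lucas_u a n) - of_nat k = of_int X"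
      using u0 by (simp add: U u_def)
    then show "padic_val l (of_int (lucas_u a (n * k)) / of_int (lucas_u a n) - of_nat k)
              = 2 * r + \<tau> - h"
      using X by (simp add: padic_val_of_int \<tau>' r h flip: p_def)
    have "rat_of_int (lucas_u a (n * k)) - of_nat k * of_int (lucas_u a n) = of_int (u * X)"
      by (simp add: U flip: u_def) (simp add: algebra_simps)
    moreover have "multiplicity p (u * X) = 3 * R + T"
      using p u0 X by (simp add: mult_distrib R_def)
    ultimately show "padic_val l (of_int (lucas_u a (n * k)) - of_nat k * of_int (lucas_u a n))
              = 3 * r + \<tau> - h"
      using X u0 by (simp add: padic_val_of_int \<tau>' r h del: of_int_mult flip: p_def)
  next
    assume less: "\<tau>' < 2 * r"
    define K where "K = (int k)\<^sup>2 - 1"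
    define S where "S = (\<Sum>i\<le>m. int i)"
    have K: "8 * S = K"
      unfolding K_def S_def k by (rule sum_naturals_odd)
    have \<tau>: "\<tau>' = padic_val l (of_int K)"
      by (simp add: assms(13) K_def)
    have "K \<noteq> 0"
      using less by (auto simp: \<tau> padic_val_def r)
    then have S0: "S \<noteq> 0" using K by auto
    define T where "T = multiplicity p S"
    \<comment> \<open>Only the factor 8, prime to p, separates K from S, so no correction arises
      here.\<close>
    have "multiplicity p K = T"
      using S0 odd_prime_not_dvd_8[OF assms(6,7), folded p_def]
      by (simp add: mult_distrib T_def not_dvd_imp_multiplicity_0 flip: K)
    then have \<tau>': "\<tau>' = ereal (real T)"
      using \<tau> \<open>K \<noteq> 0\<close> by (simp add: padic_val_of_int p_def)
    have "T < 2 * R"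
      using less by (simp add: \<tau>' r)
    obtain t where t: "lucas_v v k = v * (1 + S * D + D\<^sup>2 * t)"
      using lucas_v_odd_expansion[of v m] unfolding D_def S_def m by blast
    define X where "X = S * D + D\<^sup>2 * t"
    have X: "X \<noteq> 0" "multiplicity p X = 2 * R + T"
      using multiplicity_linear_term[OF p D0 S0, of t] \<open>T < 2 * R\<close> by (auto simp: mD X_def T_def)
    \<comment> \<open>As p divides D = v^2 - 4, dividing v would force p to divide 4. So the factor
      v of the difference v X contributes nothing.\<close>
    have "\<not> p dvd v"
    proof
      assume "p dvd v"
      moreover have "p dvd D"
        using assms(9) by (simp add: D p_def u_def power2_eq_square)
      ultimately have "p dvd v * v - D" by simp
      then have "p dvd 4"
        by (simp add: D_def power2_eq_square)
      then have "p dvd 4 * 2" by (rule dvd_mult2)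
      then show False
        using odd_prime_not_dvd_8[OF assms(6,7)] by (simp add: p_def)
    qed
    then have v: "v \<noteq> 0" "multiplicity p v = 0"
      by (auto intro: not_dvd_imp_multiplicity_0)
    have "rat_of_int (lucas_v a (n * k)) - of_int (lucas_v a n) = of_int (v * X)"
      unfolding lucas_v_mult X_def v_def[symmetric] t by (simp add: algebra_simps)
    moreover have "multiplicity p (v * X) = 2 * R + T"
      using p v X by (simp add: mult_distrib)
    ultimately show "padic_val l (of_int (lucas_v a (n * k)) - of_int (lucas_v a n)) = 2 * r + \<tau>'"
      using X v by (simp add: padic_val_of_int \<tau>' r del: of_int_mult flip: p_def)
  qed
qed

end
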